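(* Let $P$ be a $5$-dimensional reflexive polytope with $\delta$-vector $(1,\delta_1,\delta_2,\delta_2,\delta_1,1)$. Then $P$ is real if and only if either (i) $\delta_1=237$ and $\delta_2=1682$, or (ii) $\delta_2>7\delta_1+23$, $71\delta_1\leq 9\delta_2+1689$, and $41(\delta_1+9\delta_2-9)^2\leq 2(41\delta_1+96)^2+2(41\delta_2-85)^2$.
   Context: A $d$-dimensional lattice polytope is a full-dimensional convex polytope $P\subset\mathbb{Z}^d\otimes_{\mathbb{Z}}\mathbb{Q}$ with vertices in $\mathbb{Z}^d$. It is reflexive if its dual $P^*:=\{u\in\mathbb{Z}^d\otimes_{\mathbb{Z}}\mathbb{Q}\mid\langle u,v\rangle\geq -1\text{ for all }v\in P\}$ is also a lattice polytope. The Ehrhart polynomial $L_P$ is the degree-$d$ polynomial with $L_P(m)=|mP\cap\mathbb{Z}^d|$ for all integers $m\geq 0$, regarded as a polynomial over $\mathbb{C}$. The $\delta$-vector $(\delta_0,\ldots,\delta_d)$ of $P$ is defined by $\sum_{m\geq 0}L_P(m)t^m=\frac{\delta_0+\delta_1t+\cdots+\delta_dt^d}{(1-t)^{d+1}}$; for reflexive $P$ it is palindromic with $\delta_0=1$. $P$ is real if every root $z\in\mathbb{C}$ of $L_P$ satisfies $\operatorname{Im}(z)=0$. *)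

theory Defs
  imports "HOL-Analysis.Analysis" "HOL-Computational_Algebra.Computational_Algebra"
begin

text \<open>
  Polytopes are taken in \<open>\<real>\<^sup>d = real ^ 'd\<close>, with \<open>d = CARD('d)\<close>, instead of
  \<open>\<int>\<^sup>d \<otimes> \<rat>\<close>. Polytopes with vertices in \<open>\<int>\<^sup>d\<close> are the same objects over
  either field, and extension of scalars is compatible with duality and with counting the
  lattice points of dilates.
\<close>

definition integer_lattice :: "(real ^ 'd) set" where
  "integer_lattice = {x. \<forall>i. x $ i \<in> \<int>}"

definition lattice_polytope :: "(real ^ 'd) set \<Rightarrow> bool" where
  "lattice_polytope P \<longleftrightarrow>
     polytope P \<and> aff_dim P = int CARD('d) \<and>
     (\<forall>v. v extreme_point_of P \<longrightarrow> v \<in> integer_lattice)"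

definition dual_polytope :: "(real ^ 'd) set \<Rightarrow> (real ^ 'd) set" where
  "dual_polytope P = {u. \<forall>v\<in>P. u \<bullet> v \<ge> -1}"

definition reflexive_polytope :: "(real ^ 'd) set \<Rightarrow> bool" where
  "reflexive_polytope P \<longleftrightarrow> lattice_polytope P \<and> lattice_polytope (dual_polytope P)"

definition lattice_count :: "(real ^ 'd) set \<Rightarrow> nat \<Rightarrow> nat" where
  "lattice_count P m = card ((\<lambda>x. real m *\<^sub>R x) ` P \<inter> integer_lattice)"

definition ehrhart_poly :: "(real ^ 'd) set \<Rightarrow> complex poly" where
  "ehrhart_poly P =
     (THE L. degree L = CARD('d) \<and> (\<forall>m. poly L (of_nat m) = of_nat (lattice_count P m)))"

text \<open>
  The series is formed from the numbers \<open>|mP \<inter> \<int>\<^sup>d| = L\<^sub>P(m)\<close> themselves. The quotient is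
  one of formal power series over a field, and the denominator is invertible there; the list
  of entries is determined uniquely by \<open>P\<close>.
\<close>

definition has_delta_vector :: "(real ^ 'd) set \<Rightarrow> int list \<Rightarrow> bool" where
  "has_delta_vector P \<delta> \<longleftrightarrow>
     length \<delta> = CARD('d) + 1 \<and>
     Abs_fps (\<lambda>m. of_nat (lattice_count P m) :: complex) =
       fps_of_poly (Poly (map of_int \<delta>)) / (1 - fps_X) ^ (CARD('d) + 1)"

definition real_polytope :: "(real ^ 'd) set \<Rightarrow> bool" where
  "real_polytope P \<longleftrightarrow> (\<forall>z. poly (ehrhart_poly P) z = 0 \<longrightarrow> Im z = 0)"

end

theory Submission
  imports Defs
begin

text \<open>
  Palindromicity of the \<open>\<delta>\<close>-vector makes \<open>L\<^sub>P\<close> odd about \<open>-1/2\<close>: with \<open>x = z + 1/2\<close>,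
  \<open>60 L\<^sub>P(z) = x (A x\<^sup>4 + B x\<^sup>2 + C)\<close> where \<open>A\<close>, \<open>B\<close>, \<open>C\<close> are affine in \<open>\<delta>\<^sub>1\<close>, \<open>\<delta>\<^sub>2\<close>.
  Here \<open>A > 0\<close>, since \<open>P\<close> contains a box and so has at least of the order of \<open>m\<^sup>5\<close> lattice
  points in its dilates \<open>mP\<close>. All roots are therefore real iff the quadratic in \<open>x\<^sup>2\<close> has only
  real nonnegative roots, i.e. \<open>4AC \<le> B\<^sup>2\<close>, \<open>B \<le> 0\<close> and \<open>C \<ge> 0\<close>. The boundary case \<open>B = 0\<close>
  forces \<open>C = 0\<close> and yields the exceptional pair \<open>(237, 1682)\<close>.
\<close>

section \<open>Counting lattice points in dilates\<close>

lemma finite_bounded_Int_integer_lattice: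
  fixes S :: "(real ^ 'd) set"
  assumes "bounded S"
  shows "finite (S \<inter> integer_lattice)"
proof -
  obtain K where K: "\<And>x. x \<in> S \<Longrightarrow> norm x \<le> K"
    using assms by (auto simp: bounded_iff)
  define F where "F = (\<Pi>\<^sub>E i\<in>(UNIV :: 'd set). {-\<lceil>K\<rceil>..\<lceil>K\<rceil>})"
  have "finite F"
    unfolding F_def by (intro finite_PiE) auto
  moreover define h :: "('d \<Rightarrow> int) \<Rightarrow> real ^ 'd" where "h = (\<lambda>f. \<chi> i. of_int (f i))"
  have "S \<inter> integer_lattice \<subseteq> h ` F"
  proof
    fix x assume x: "x \<in> S \<inter> integer_lattice"
    have eq: "real_of_int \<lfloor>x $ i\<rfloor> = x $ i" for i
      using x by (auto simp: integer_lattice_def)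
    have "\<lfloor>x $ i\<rfloor> \<in> {-\<lceil>K\<rceil>..\<lceil>K\<rceil>}" for i
    proof -
      have "\<bar>x $ i\<bar> \<le> K"
        using component_le_norm_cart[of x i] K[of x] x by auto
      with eq[of i] have "\<bar>real_of_int \<lfloor>x $ i\<rfloor>\<bar> \<le> real_of_int \<lceil>K\<rceil>"
        by linarith
      then show ?thesis
        by (auto simp: abs_le_iff)
    qed
    then have "(\<lambda>i. \<lfloor>x $ i\<rfloor>) \<in> F"
      by (auto simp: F_def)
    moreover have "x = h (\<lambda>i. \<lfloor>x $ i\<rfloor>)"
      by (simp add: h_def vec_eq_iff eq)
    ultimately show "x \<in> h ` F"
      by blast
  qed
  ultimately show ?thesis
    by (metis finite_imageI finite_subset)
qed

text \<open>\<open>P\<close> contains a box whose sides all exceed \<open>1 / N\<close>. In the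
  dilate by \<open>N * k\<close> each side has length at least \<open>k\<close> and so holds
  \<open>k\<close> consecutive integers. Multiples of \<open>N\<close> suffice for a growth
  estimate.\<close>

lemma lattice_count_ge_power:
  fixes P :: "(real ^ 'd) set"
  assumes "bounded P" "interior P \<noteq> {}"
  obtains N where "N > 0" "\<And>k. k ^ CARD('d) \<le> lattice_count P (N * k)"
proof -
  obtain x where "x \<in> interior P"
    using assms(2) by blast
  then obtain a b where ab: "cbox a b \<subseteq> interior P" "\<forall>i\<in>Basis. a \<bullet> i < b \<bullet> i"
    using open_contains_cbox[of "interior P" x] by (metis open_interior)
  have lt: "a $ i < b $ i" for i
    using ab(2) by (auto simp: Basis_vec_def inner_axis)
  define d where "d = Min (range (\<lambda>i. b $ i - a $ i))"
  have d: "d \<le> b $ i - a $ i" for i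
    unfolding d_def by (rule Min_le) auto
  have "d > 0"
    unfolding d_def using lt by (subst Min_gr_iff) auto
  then obtain N where N: "N > 0" "inverse (real N) < d"
    using ex_inverse_of_nat_less by blast
  have "k ^ CARD('d) \<le> lattice_count P (N * k)" for k
  proof (cases "k = 0")
    case False
    define m where "m = real (N * k)"
    have m: "m > 0"
      using N False by (simp add: m_def)
    have side: "real k \<le> m * b $ i - m * a $ i" for i
    proof -
      have "1 \<le> real N * d"
        using N by (simp add: field_simps)
      also have "\<dots> \<le> real N * (b $ i - a $ i)"
        using d[of i] by (intro mult_left_mono) auto
      finally have "real k * 1 \<le> real k * (real N * (b $ i - a $ i))"
        by (intro mult_left_mono) auto
      then show ?thesis
        by (simp add: m_def algebra_simps)
    qed
    define F where "F = (\<Pi>\<^sub>E i\<in>(UNIV :: 'd set). {0..<int k})"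
    define g :: "('d \<Rightarrow> int) \<Rightarrow> real ^ 'd"
      where "g = (\<lambda>f. \<chi> i. of_int (\<lceil>m * a $ i\<rceil> + f i))"
    have "inj_on g F"
      by (auto simp: inj_on_def g_def vec_eq_iff)
    moreover have "g ` F \<subseteq> (\<lambda>x. m *\<^sub>R x) ` P \<inter> integer_lattice"
    proof
      fix y assume "y \<in> g ` F"
      then obtain f where f: "f \<in> F" "y = g f" by blast
      have "m * a $ i \<le> y $ i \<and> y $ i \<le> m * b $ i" for i
      proof -
        have "f i \<in> {0..<int k}"
          using f by (auto simp: F_def PiE_def Pi_def)
        \<comment> \<open>The ceiling exceeds \<open>m * a $ i\<close> by less than 1, so
          \<open>f i\<close> up to \<open>k - 1\<close> keeps the point below the upper side of the
          box.\<close>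
        then have "0 \<le> real_of_int (f i)" "real_of_int (f i) \<le> real k - 1"
          by auto
        then show ?thesis
          using side[of i] unfolding f(2) g_def by simp linarith
      qed
      then have "(1 / m) *\<^sub>R y \<in> cbox a b"
        using m by (auto simp: mem_box_cart field_simps)
      then have "(1 / m) *\<^sub>R y \<in> P"
        using ab(1) interior_subset by blast
      moreover have "y = m *\<^sub>R ((1 / m) *\<^sub>R y)"
        using m by simp
      ultimately have "y \<in> (\<lambda>x. m *\<^sub>R x) ` P"
        by blast
      moreover have "y \<in> integer_lattice"
        by (simp add: f(2) g_def integer_lattice_def)
      ultimately show "y \<in> (\<lambda>x. m *\<^sub>R x) ` P \<inter> integer_lattice"
        by blast
    qed
    \<comment> \<open>\<open>card\<close> is 0 on infinite sets, so the injection bounds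
      \<open>lattice_count\<close> only once finiteness is known.\<close>
    moreover have "finite ((\<lambda>x. m *\<^sub>R x) ` P \<inter> integer_lattice)"
      using assms(1) by (intro finite_bounded_Int_integer_lattice bounded_scaling)
    moreover have "card F = k ^ CARD('d)"
      by (simp add: F_def card_PiE)
    ultimately show ?thesis
      unfolding lattice_count_def m_def by (metis card_inj_on_le)
  qed (simp add: zero_power)
  with N(1) that show ?thesis
    by blast
qed

text \<open>Full affine dimension turns the relative interior into the interior, and a nonempty
  convex set has nonempty relative interior.\<close>

lemma lattice_polytope_interior_nonempty:
  fixes P :: "(real ^ 'd) set"
  assumes "lattice_polytope P"
  shows "interior P \<noteq> {}"
proof -
  have dim: "aff_dim P = int DIM(real ^ 'd)" and "convex P"
    using assms by (auto simp: lattice_polytope_def polytope_imp_convex)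
  have "P \<noteq> {}"
    using dim by auto
  moreover have "rel_interior P = interior P"
    using dim aff_dim_eq_full rel_interior_interior by blast
  ultimately show ?thesis
    using \<open>convex P\<close> rel_interior_eq_empty by metis
qed

section \<open>From the \<delta>-vector to the Ehrhart polynomial\<close>

text \<open>Evaluates the definite description from one exhibited polynomial: two of degree
  \<open>CARD('d)\<close> that agree at \<open>CARD('d) + 1\<close> points coincide.\<close>

lemma ehrhart_poly_eqI:
  fixes P :: "(real ^ 'd) set"
  assumes "degree L = CARD('d)"
    and "\<And>m. poly L (of_nat m) = of_nat (lattice_count P m)"
  shows "ehrhart_poly P = L"
  unfolding ehrhart_poly_def
proof (rule the_equality)
  fix L' :: "complex poly"
  assume L': "degree L' = CARD('d) \<and> (\<forall>m. poly L' (of_nat m) = of_nat (lattice_count P m))"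
  show "L' = L"
  proof (rule poly_eqI_degree[where A = "of_nat ` {..CARD('d)}"])
    show "poly L' x = poly L x" if "x \<in> of_nat ` {..CARD('d)}" for x
      using that L' assms(2) by auto
    have "card (of_nat ` {..CARD('d)} :: complex set) = CARD('d) + 1"
      by (subst card_image) (auto simp: inj_on_def)
    then show "card (of_nat ` {..CARD('d)} :: complex set) > degree L'"
      and "card (of_nat ` {..CARD('d)} :: complex set) > degree L"
      using L' assms(1) by auto
  qed
qed (use assms in auto)

lemma of_nat_binomial_5:
  "(of_nat ((n + 5) choose 5) :: 'a :: field_char_0) =
     (of_nat n + 1) * (of_nat n + 2) * (of_nat n + 3) * (of_nat n + 4) * (of_nat n + 5) / 120"
  unfolding binomial_gbinomial
  by (simp add: gbinomial_prod_rev numeral_eq_Suc fact_Suc) (simp add: algebra_simps)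

text \<open>Coefficient \<open>m\<close> of the series sums the \<delta>-entries with index j
  against H(m - j), where H(n) is n + 5 choose 5. As a polynomial, H satisfies H(-6 - x) = -H(x), so
  pairing j with 5 - j makes the palindromic sum odd about -1/2. The factor 60 is half of 5!, since
  the \<delta>-entries sum to \<open>2 * (1 + d + e)\<close>.\<close>

lemma lattice_count_palindromic_5:
  fixes P :: "(real ^ 5) set" and d e :: int
  assumes "has_delta_vector P [1, d, e, e, d, 1]"
  shows "60 * complex_of_nat (lattice_count P m) =
    (of_nat m + 1/2) *
     ((1 + of_int d + of_int e) * (of_nat m + 1/2) ^ 4 +
      (115 + 35 * of_int d - 5 * of_int e) / 2 * (of_nat m + 1/2) ^ 2 +
      (1689 - 71 * of_int d + 9 * of_int e) / 16)"
proof -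
  define G where "G = inverse ((1 - fps_X) ^ 6 :: complex fps)"
  define H where "H = (\<lambda>n. (of_nat n + 1) * (of_nat n + 2) * (of_nat n + 3) * (of_nat n + 4)
    * (of_nat n + 5) / 120 :: complex)"
  have G: "fps_nth G n = H n" for n
  proof -
    have "fps_nth G n = of_nat ((6 + n - 1) choose n)"
      using one_minus_const_fps_X_neg_power'[of 6 "1 :: complex"] by (simp add: G_def)
    also have "(6 + n - 1) choose n = (n + 5) choose 5"
      using binomial_symmetric[of n "n + 5"] by (simp add: add.commute)
    finally show ?thesis
      by (simp add: H_def of_nat_binomial_5)
  qed
  have "Abs_fps (\<lambda>m. of_nat (lattice_count P m) :: complex) =
      fps_of_poly (Poly (map of_int [1, d, e, e, d, 1])) * G"
    using assms unfolding has_delta_vector_def G_def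
    by (simp add: fps_divide_unit)
  \<comment> \<open>Horner form: each \<open>fps_X\<close> becomes a single index shift, and taking
    coefficients yields nested conditionals.\<close>
  also have "\<dots> = G + fps_X * (fps_const (of_int d) * G + fps_X * (fps_const (of_int e) * G +
      fps_X * (fps_const (of_int e) * G + fps_X * (fps_const (of_int d) * G + fps_X * G))))"
    by (simp add: fps_of_poly_pCons algebra_simps)
  finally have "complex_of_nat (lattice_count P m) = fps_nth \<dots> m"
    by (metis fps_nth_Abs_fps)
  then have *: "complex_of_nat (lattice_count P m) =
      H m + (if m = 0 then 0 else of_int d * H (m - 1) + (if m - 1 = 0 then 0 else
      of_int e * H (m - 2) + (if m - 2 = 0 then 0 else of_int e * H (m - 3) +
      (if m - 3 = 0 then 0 else of_int d * H (m - 4) + (if m - 4 = 0 then 0 else H (m - 5))))))"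
    by (simp add: G numeral_eq_Suc)
  \<comment> \<open>For \<open>m < 5\<close> the conditionals drop the terms with j > m. The formula
    persists because the polynomial H vanishes at -1, ..., -5; these five values of \<open>m\<close>
    are checked one by one. Otherwise \<open>m = n + 5\<close> avoids truncated subtraction.\<close>
  consider "m < 5" | n where "m = n + 5"
    by (metis add.commute le_Suc_ex not_less)
  then show ?thesis
  proof cases
    case 1
    then have "m \<in> {0, 1, 2, 3, 4}"
      by auto
    then show ?thesis
      unfolding * H_def
      by (elim insertE emptyE) (simp_all add: field_simps power_numeral_reduce)
  next
    case (2 n)
    define t where "t = complex_of_nat n"
    have "H (n + 5) = (t+6) * (t+7) * (t+8) * (t+9) * (t+10) / 120"
      "H (n + 4) = (t+5) * (t+6) * (t+7) * (t+8) * (t+9) / 120"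
      "H (n + 3) = (t+4) * (t+5) * (t+6) * (t+7) * (t+8) / 120"
      "H (n + 2) = (t+3) * (t+4) * (t+5) * (t+6) * (t+7) / 120"
      "H (n + 1) = (t+2) * (t+3) * (t+4) * (t+5) * (t+6) / 120"
      "H n = (t+1) * (t+2) * (t+3) * (t+4) * (t+5) / 120"
      by (simp_all add: H_def t_def add_ac)
    moreover have "complex_of_nat (lattice_count P m) = H (n + 5) + (of_int d * H (n + 4) +
        (of_int e * H (n + 3) + (of_int e * H (n + 2) + (of_int d * H (n + 1) + H n))))"
      using * unfolding 2 by (simp add: numeral_eq_Suc)
    moreover have "complex_of_nat m = t + 5"
      by (simp add: 2 t_def)
    ultimately show ?thesis
      by (simp only:) (simp add: field_simps power_numeral_reduce)
  qed
qed

section \<open>Real-rootedness of biquadratics\<close>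

text \<open>A complex number is real iff its square is real and nonnegative, which reduces the claim
  to a quadratic in \<open>w = x\<^sup>2\<close>. Its discriminant decides reality; the sum
  \<open>- b / a\<close> and product \<open>c / a\<close> of its roots then decide their
  signs.\<close>

lemma biquadratic_roots_real_iff:
  fixes a b c :: real
  assumes "a > 0"
  shows "(\<forall>x :: complex. of_real a * x ^ 4 + of_real b * x ^ 2 + of_real c = 0 \<longrightarrow> Im x = 0)
    \<longleftrightarrow> 4 * a * c \<le> b\<^sup>2 \<and> b \<le> 0 \<and> c \<ge> 0" (is "?L \<longleftrightarrow> ?R")
proof
  assume L: ?L
  have nonneg: "Im w = 0 \<and> Re w \<ge> 0" if "of_real a * w ^ 2 + of_real b * w + of_real c = 0"
    for w :: complex
  proof -
    have "csqrt w ^ 4 = w ^ 2"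
      by (metis numeral_Bit0 power2_csqrt power_add power2_eq_square)
    then have "Im (csqrt w) = 0"
      using L[rule_format, of "csqrt w"] that by (metis power2_csqrt)
    then have "csqrt w = of_real (Re (csqrt w))"
      by (simp add: complex_eq_iff)
    then have "w = of_real ((Re (csqrt w))\<^sup>2)"
      by (metis of_real_power power2_csqrt)
    then show ?thesis
      by (metis Im_complex_of_real Re_complex_of_real zero_le_power2)
  qed
  define D where "D = b\<^sup>2 - 4 * a * c"
  \<comment> \<open>The quadratic formula for an arbitrary complex square root \<open>s\<close> of
    \<open>D\<close> serves both the imaginary \<open>s\<close> that refutes \<open>D < 0\<close>
    and the choice \<open>s = - sqrt D\<close>.\<close>
  have root: "of_real a * ((- of_real b + s) / of_real (2 * a)) ^ 2 +
      of_real b * ((- of_real b + s) / of_real (2 * a)) + of_real c = 0"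
    if "s ^ 2 = of_real D" for s :: complex
  proof -
    have s: "s * s = of_real b * of_real b - 4 * of_real a * of_real c"
      using that by (simp add: D_def power2_eq_square)
    define w where "w = (- of_real b + s) / of_real (2 * a)"
    have w: "2 * of_real a * w = s - of_real b"
      using assms by (simp add: w_def)
    have "4 * of_real a * (of_real a * w\<^sup>2 + of_real b * w + of_real c) =
      (2 * of_real a * w) * (2 * of_real a * w) + 2 * of_real b * (2 * of_real a * w) +
      4 * of_real a * of_real c"
      by (simp add: power2_eq_square algebra_simps)
    also have "\<dots> = 0"
      unfolding w using s by (simp add: algebra_simps)
    finally show ?thesis
      using assms by (simp add: w_def)
  qed
  have D: "D \<ge> 0"
  proof (rule ccontr)
    assume neg: "\<not> D \<ge> 0"
    define s where "s = \<i> * of_real (sqrt (- D))"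
    have "s ^ 2 = of_real D"
      using neg by (simp add: s_def power_mult_distrib flip: of_real_power)
    from nonneg[OF root[OF this]] have "sqrt (- D) = 0"
      using assms by (simp add: s_def Im_divide_of_real)
    then show False using neg by simp
  qed
  \<comment> \<open>Nonnegativity of the smaller root gives \<open>sqrt D \<le> - b\<close>, which
    contains both remaining conditions: \<open>b \<le> 0\<close>, and
    \<open>D \<le> b\<^sup>2\<close>, that is \<open>a * c \<ge> 0\<close>.\<close>
  have "(of_real (- sqrt D)) ^ 2 = complex_of_real D"
    using D by (simp flip: of_real_power)
  from nonneg[OF root[OF this]] have "Re ((- of_real b + of_real (- sqrt D)) / of_real (2 * a)) \<ge> 0"
    by blast
  then have "- b - sqrt D \<ge> 0"
    using assms by (simp add: Re_divide_of_real field_simps)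
  then have b: "sqrt D \<le> - b" by simp
  then have "b \<le> 0"
    using D real_sqrt_ge_zero[of D] by linarith
  moreover have "D \<le> b\<^sup>2"
    using power_mono[OF b, of 2] D by simp
  then have "a * c \<ge> 0"
    by (simp add: D_def)
  then have "c \<ge> 0"
    using assms by (simp add: zero_le_mult_iff)
  ultimately show ?R
    using D by (simp add: D_def)
next
  assume R: ?R
  define s where "s = sqrt (b\<^sup>2 - 4 * a * c)"
  have s2: "s\<^sup>2 = b\<^sup>2 - 4 * a * c" and s0: "s \<ge> 0"
    using R by (auto simp: s_def)
  \<comment> \<open>Together with \<open>s \<ge> 0\<close> this makes both roots
    \<open>(- b + s) / (2 * a)\<close> and \<open>(- b - s) / (2 * a)\<close> nonnegative.\<close>
  have sb: "s \<le> - b"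
  proof (rule power2_le_imp_le)
    show "s\<^sup>2 \<le> (- b)\<^sup>2"
      using R assms by (simp add: s2)
  qed (use R in simp)
  show ?L
  proof (intro allI impI)
    fix x :: complex
    assume x: "of_real a * x ^ 4 + of_real b * x ^ 2 + of_real c = 0"
    define w where "w = x\<^sup>2"
    have w: "of_real a * w\<^sup>2 + of_real b * w + of_real c = 0"
      using x by (simp add: w_def flip: power_mult)
    have "(2 * of_real a * w + of_real b - of_real s) * (2 * of_real a * w + of_real b + of_real s)
      = 4 * of_real a * (of_real a * w\<^sup>2 + of_real b * w) + of_real (b\<^sup>2) - of_real (s\<^sup>2)"
      by (simp add: power2_eq_square algebra_simps)
    also have "\<dots> = 4 * of_real a * (of_real a * w\<^sup>2 + of_real b * w + of_real c)"
      by (simp add: s2 algebra_simps)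
    finally have "2 * of_real a * w + of_real b - of_real s = 0 \<or>
        2 * of_real a * w + of_real b + of_real s = 0"
      using w by simp
    then obtain t where t: "2 * of_real a * w + of_real b = of_real t" "t = s \<or> t = - s"
      by (metis add_eq_0_iff add.commute eq_iff_diff_eq_0 of_real_minus)
    have "2 * a * Im w = 0" "2 * a * Re w + b = t"
      using t(1) by (auto simp: complex_eq_iff)
    then have "Im w = 0" "2 * a * Re w \<ge> 0"
      using assms sb t(2) s0 by auto
    \<comment> \<open>These are the imaginary and real parts of \<open>w = x\<^sup>2\<close>; a
      purely imaginary nonzero \<open>x\<close> would violate the second.\<close>
    then have "Re x * Im x = 0" "(Re x)\<^sup>2 \<ge> (Im x)\<^sup>2"
      using assms by (auto simp: w_def Re_power2 Im_power2 zero_le_mult_iff)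
    then show "Im x = 0"
      by auto
  qed
qed

section \<open>Positivity of the leading coefficient\<close>

text \<open>If \<open>A \<le> 0\<close>, oddness leaves the cubic term as the next one, so the
  counts grow at most like m^3. Full dimension forces growth of order m^5 along the multiples of
  \<open>N\<close>.\<close>

lemma palindromic_5_leading_coeff_pos:
  fixes P :: "(real ^ 5) set" and d e :: int
  assumes "lattice_polytope P" "has_delta_vector P [1, d, e, e, d, 1]"
  shows "1 + d + e > 0"
proof (rule ccontr)
  assume neg: "\<not> 1 + d + e > 0"
  define A B C where "A = 1 + real_of_int d + of_int e"
    and "B = (115 + 35 * real_of_int d - 5 * of_int e) / 2"
    and "C = (1689 - 71 * real_of_int d + 9 * of_int e) / 16"
  have "bounded P"
    using assms(1) by (simp add: lattice_polytope_def polytope_imp_bounded)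
  then obtain N where N: "N > 0" "\<And>k. k ^ 5 \<le> lattice_count P (N * k)"
    using lattice_count_ge_power[of P] lattice_polytope_interior_nonempty[OF assms(1)] by auto
  have count: "60 * real (lattice_count P m) =
      (real m + 1/2) * (A * (real m + 1/2) ^ 4 + B * (real m + 1/2) ^ 2 + C)" for m
  proof -
    have "complex_of_real (60 * real (lattice_count P m)) =
      of_real ((real m + 1/2) * (A * (real m + 1/2) ^ 4 + B * (real m + 1/2) ^ 2 + C))"
      using lattice_count_palindromic_5[OF assms(2), of m] by (simp add: A_def B_def C_def)
    then show ?thesis
      using of_real_eq_iff by blast
  qed
  have "A \<le> 0"
    using neg unfolding A_def by linarith
  define M where "M = \<bar>B\<bar> + \<bar>C\<bar>"
  \<comment> \<open>Comparing \<open>k ^ 5\<close> with the cubic bound and cancelling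
    \<open>k ^ 3\<close> bounds \<open>k ^ 2\<close> by a constant. The 8 is the cube of the 2 in
    \<open>x \<le> 2 * real (N * k)\<close>.\<close>
  have bound: "60 * real k ^ 2 \<le> 8 * M * real N ^ 3" if "k > 0" for k
  proof -
    define x where "x = real (N * k) + 1/2"
    have "1 \<le> N * k"
      using N(1) that by simp
    then have "1 \<le> real (N * k)"
      by linarith
    then have x: "1 \<le> x" "x \<le> 2 * real (N * k)"
      by (auto simp: x_def)
    have "B * x\<^sup>2 \<le> \<bar>B\<bar> * x\<^sup>2"
      by (intro mult_right_mono) auto
    moreover have "C \<le> \<bar>C\<bar> * x\<^sup>2"
      using mult_left_mono[of 1 "x\<^sup>2" "\<bar>C\<bar>"] x(1) by auto
    moreover have "A * x ^ 4 \<le> 0"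
      using \<open>A \<le> 0\<close> by (simp add: mult_nonpos_nonneg)
    ultimately have "A * x ^ 4 + B * x\<^sup>2 + C \<le> M * x\<^sup>2"
      by (simp add: M_def algebra_simps)
    then have "x * (A * x ^ 4 + B * x\<^sup>2 + C) \<le> x * (M * x\<^sup>2)"
      using x(1) by (intro mult_left_mono) auto
    also have "\<dots> = M * x ^ 3"
      by (simp add: power_numeral_reduce)
    also have "\<dots> \<le> M * (2 * real (N * k)) ^ 3"
      using x by (intro mult_left_mono power_mono) (auto simp: M_def)
    finally have "60 * real (lattice_count P (N * k)) \<le> M * (2 * real (N * k)) ^ 3"
      by (simp add: count x_def)
    moreover have "real k ^ 5 \<le> real (lattice_count P (N * k))"
      using N(2)[of k] by (metis of_nat_le_iff of_nat_power)
    ultimately have "60 * real k ^ 5 \<le> M * (2 * real (N * k)) ^ 3"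
      by linarith
    then have "(60 * real k ^ 2) * real k ^ 3 \<le> (8 * M * real N ^ 3) * real k ^ 3"
      by (simp add: power_mult_distrib power_numeral_reduce mult_ac)
    then show ?thesis
      using that by (simp add: mult_le_cancel_right)
  qed
  obtain k where k: "8 * M * real N ^ 3 < real k"
    using reals_Archimedean2 by blast
  have "8 * M * real N ^ 3 < real (Suc k)" "real (Suc k) \<le> real (Suc k) ^ 2"
    using k by (auto simp: power2_eq_square)
  with bound[of "Suc k"] show False
    by (smt (verit) zero_less_Suc of_nat_0_le_iff)
qed

section \<open>The criterion in terms of \<open>\<delta>\<^sub>1\<close> and
  \<open>\<delta>\<^sub>2\<close>\<close>

theorem theorem4p4:
  fixes P :: "(real ^ 5) set" and \<delta>\<^sub>1 \<delta>\<^sub>2 :: int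
  assumes "reflexive_polytope P"
    and "has_delta_vector P [1, \<delta>\<^sub>1, \<delta>\<^sub>2, \<delta>\<^sub>2, \<delta>\<^sub>1, 1]"
  shows "real_polytope P \<longleftrightarrow>
    (\<delta>\<^sub>1 = 237 \<and> \<delta>\<^sub>2 = 1682) \<or>
    (\<delta>\<^sub>2 > 7 * \<delta>\<^sub>1 + 23 \<and>
     71 * \<delta>\<^sub>1 \<le> 9 * \<delta>\<^sub>2 + 1689 \<and>
     41 * (\<delta>\<^sub>1 + 9 * \<delta>\<^sub>2 - 9)\<^sup>2 \<le> 2 * (41 * \<delta>\<^sub>1 + 96)\<^sup>2 + 2 * (41 * \<delta>\<^sub>2 - 85)\<^sup>2)"
proof -
  define A B C where "A = 1 + real_of_int \<delta>\<^sub>1 + of_int \<delta>\<^sub>2"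
    and "B = (115 + 35 * real_of_int \<delta>\<^sub>1 - 5 * of_int \<delta>\<^sub>2) / 2"
    and "C = (1689 - 71 * real_of_int \<delta>\<^sub>1 + 9 * of_int \<delta>\<^sub>2) / 16"
  have pos: "1 + \<delta>\<^sub>1 + \<delta>\<^sub>2 > 0"
    using assms palindromic_5_leading_coeff_pos by (auto simp: reflexive_polytope_def)
  then have "A > 0"
    unfolding A_def by linarith
  define L where "L = smult (1/60) ([:1/2, 1:] *
    pcompose [:complex_of_real C, 0, of_real B, 0, of_real A:] [:1/2, 1:])"
  have L: "poly L z = (z + 1/2) *
      (of_real A * (z + 1/2) ^ 4 + of_real B * (z + 1/2)\<^sup>2 + of_real C) / 60" for z
  proof -
    have "poly [:complex_of_real C, 0, of_real B, 0, of_real A:] x =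
        of_real A * x ^ 4 + of_real B * x\<^sup>2 + of_real C" for x
      by (simp add: power_numeral_reduce algebra_simps)
    moreover have "poly [:1/2, 1:] z = z + 1/2"
      by simp
    ultimately show ?thesis
      by (simp only: L_def poly_smult poly_mult poly_pcompose) simp
  qed
  have "ehrhart_poly P = L"
  proof (rule ehrhart_poly_eqI)
    \<comment> \<open>Nonvanishing makes degrees additive; \<open>A > 0\<close> then gives degree 1
      + 4.\<close>
    have "pcompose [:complex_of_real C, 0, of_real B, 0, of_real A:] [:1/2, 1:] \<noteq> 0"
      using \<open>A > 0\<close> by (subst pcompose_eq_0_iff) auto
    then show "degree L = CARD(5)"
      using \<open>A > 0\<close> by (simp add: L_def degree_mult_eq degree_pcompose del: mult_pCons_left)
    show "poly L (of_nat m) = of_nat (lattice_count P m)" for m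
      using lattice_count_palindromic_5[OF assms(2), of m]
      by (simp add: L A_def B_def C_def mult.commute[of _ 60])
  qed
  then have "real_polytope P \<longleftrightarrow> (\<forall>z. (z + 1/2) *
      (of_real A * (z + 1/2) ^ 4 + of_real B * (z + 1/2)\<^sup>2 + of_real C) = 0 \<longrightarrow> Im z = 0)"
    by (simp add: real_polytope_def L)
  \<comment> \<open>The linear factor has the real root -1/2, and the shift by 1/2 preserves
    imaginary parts.\<close>
  also have "\<dots> \<longleftrightarrow> (\<forall>x. of_real A * x ^ 4 + of_real B * x\<^sup>2 + of_real C = 0 \<longrightarrow> Im x = 0)"
    (is "?l \<longleftrightarrow> ?r")
  proof
    assume l: ?l
    show ?r
    proof (intro allI impI)
      fix x :: complex
      assume "of_real A * x ^ 4 + of_real B * x\<^sup>2 + of_real C = 0"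
      then have "Im (x - 1/2) = 0"
        using l[rule_format, of "x - 1/2"] by simp
      then show "Im x = 0" by simp
    qed
  next
    assume r: ?r
    show ?l
    proof (intro allI impI)
      fix z :: complex
      assume "(z + 1/2) * (of_real A * (z + 1/2) ^ 4 + of_real B * (z + 1/2)\<^sup>2 + of_real C) = 0"
      then have "Im (z + 1/2) = 0"
        using r[rule_format, of "z + 1/2"] by (auto simp del: plus_complex.sel)
      then show "Im z = 0" by simp
    qed
  qed
  also have "\<dots> \<longleftrightarrow> 4 * A * C \<le> B\<^sup>2 \<and> B \<le> 0 \<and> C \<ge> 0"
    by (rule biquadratic_roots_real_iff) fact
  also have "B \<le> 0 \<longleftrightarrow> \<delta>\<^sub>2 \<ge> 7 * \<delta>\<^sub>1 + 23"
  proof -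
    have "B = real_of_int (115 + 35 * \<delta>\<^sub>1 - 5 * \<delta>\<^sub>2) / 2"
      by (simp add: B_def)
    then have "B \<le> 0 \<longleftrightarrow> 115 + 35 * \<delta>\<^sub>1 - 5 * \<delta>\<^sub>2 \<le> 0"
      by (simp only: divide_le_0_iff of_int_le_0_iff) simp
    then show ?thesis
      by linarith
  qed
  also have "C \<ge> 0 \<longleftrightarrow> 71 * \<delta>\<^sub>1 \<le> 9 * \<delta>\<^sub>2 + 1689"
  proof -
    have "C = real_of_int (1689 - 71 * \<delta>\<^sub>1 + 9 * \<delta>\<^sub>2) / 16"
      by (simp add: C_def)
    then have "C \<ge> 0 \<longleftrightarrow> 1689 - 71 * \<delta>\<^sub>1 + 9 * \<delta>\<^sub>2 \<ge> 0"
      by (simp only: zero_le_divide_iff of_int_0_le_iff) simp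
    then show ?thesis
      by linarith
  qed
  also have "4 * A * C \<le> B\<^sup>2 \<longleftrightarrow>
    41 * (\<delta>\<^sub>1 + 9 * \<delta>\<^sub>2 - 9)\<^sup>2 \<le> 2 * (41 * \<delta>\<^sub>1 + 96)\<^sup>2 + 2 * (41 * \<delta>\<^sub>2 - 85)\<^sup>2"
    (is "_ \<longleftrightarrow> ?X \<le> ?Y")
  proof -
    define D where "D = ?Y - ?X"
    \<comment> \<open>The third inequality is the discriminant condition scaled by 41/4.\<close>
    have "(B\<^sup>2 - 4 * A * C) * 41 = 4 * real_of_int D"
      by (simp add: A_def B_def C_def D_def power2_eq_square field_simps)
    then have "4 * A * C \<le> B\<^sup>2 \<longleftrightarrow> 0 \<le> D"
      by auto
    then show ?thesis
      by (simp add: D_def)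
  qed
  also have "(?X \<le> ?Y \<and> \<delta>\<^sub>2 \<ge> 7 * \<delta>\<^sub>1 + 23 \<and> 71 * \<delta>\<^sub>1 \<le> 9 * \<delta>\<^sub>2 + 1689) \<longleftrightarrow>
    (\<delta>\<^sub>1 = 237 \<and> \<delta>\<^sub>2 = 1682) \<or>
    (\<delta>\<^sub>2 > 7 * \<delta>\<^sub>1 + 23 \<and> 71 * \<delta>\<^sub>1 \<le> 9 * \<delta>\<^sub>2 + 1689 \<and> ?X \<le> ?Y)"
  \<comment> \<open>Weak and strict inequality differ only where \<open>B = 0\<close>. There the
    discriminant condition reads \<open>A * C \<le> 0\<close>, so \<open>C \<le> 0\<close>, and with
    \<open>C \<ge> 0\<close> only \<open>C = 0\<close> remains.\<close>
  proof (cases "\<delta>\<^sub>2 = 7 * \<delta>\<^sub>1 + 23")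
    case True
    define D E where "D = ?Y - ?X" and "E = (1 + \<delta>\<^sub>1 + \<delta>\<^sub>2) * (237 - \<delta>\<^sub>1)"
    \<comment> \<open>On this line \<open>C = (237 - \<delta>\<^sub>1) / 2\<close>, so
      \<open>E\<close> is \<open>2 * A * C\<close>. Hence 237, and 1682 = 7 * 237 + 23.\<close>
    have "2 * D = - 41 * E"
      unfolding D_def E_def True by (simp add: power2_eq_square algebra_simps)
    then have "0 \<le> D \<longleftrightarrow> E \<le> 0"
      by presburger
    then have "?X \<le> ?Y \<longleftrightarrow> (1 + \<delta>\<^sub>1 + \<delta>\<^sub>2) * (237 - \<delta>\<^sub>1) \<le> 0"
      by (simp add: D_def E_def)
    also have "\<dots> \<longleftrightarrow> 237 \<le> \<delta>\<^sub>1"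
      using pos by (simp add: mult_le_0_iff)
    finally show ?thesis
      using True by auto
  qed auto
  finally show ?thesis .
qed

end
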